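(* For any integer $n$ with $|n|\geq 2$, the Baumslag--Solitar group $BS(1,n)=\langle a,b\mid bab^{-1}=a^{n}\rangle$ has trivial pseudocentre.
   Context: For a group $G$, the pseudocentre is $P(G)=\bigcap_{x\in G}C_G(x)^G$, where $C_G(x)$ is the centralizer of $x$ in $G$ and, for a subgroup $H\leq G$, $H^G$ is the normal closure of $H$ in $G$. *)

theory Defs
  imports "HOL.Hull" "HOL-Algebra.Coset"
begin

section \<open>Pseudocentre\<close>

definition centralizer :: "('a, 'b) monoid_scheme \<Rightarrow> 'a \<Rightarrow> 'a set"
  where "centralizer G x = {g \<in> carrier G. g \<otimes>\<^bsub>G\<^esub> x = x \<otimes>\<^bsub>G\<^esub> g}"

text \<open>The smallest normal subgroup containing \<open>S\<close>; meaningful only for \<open>S \<subseteq> carrier G\<close>.\<close>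

definition normal_closure :: "('a, 'b) monoid_scheme \<Rightarrow> 'a set \<Rightarrow> 'a set"
  where "normal_closure G S = (\<lambda>N. N \<lhd> G) hull S"

definition pseudocentre :: "('a, 'b) monoid_scheme \<Rightarrow> 'a set"
  where "pseudocentre G = (\<Inter>x \<in> carrier G. normal_closure G (centralizer G x))"

lemma (in group) normal_carrier: "carrier G \<lhd> G"
  by (auto simp: normal_inv_iff subgroup_self)

lemma (in group) normal_Inter:
  assumes "\<And>N. N \<in> \<N> \<Longrightarrow> N \<lhd> G" and "\<N> \<noteq> {}"
  shows "\<Inter>\<N> \<lhd> G"
  using assms by (auto simp: normal_inv_iff intro!: subgroups_Inter)

lemma (in group) normal_closure_normal:
  assumes "S \<subseteq> carrier G"
  shows "normal_closure G S \<lhd> G"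
  unfolding normal_closure_def hull_def
  by (rule normal_Inter) (use assms normal_carrier in auto)

lemma subset_normal_closure: "S \<subseteq> normal_closure G S"
  unfolding normal_closure_def by (rule hull_subset)

lemma normal_closure_minimal: "S \<subseteq> N \<Longrightarrow> N \<lhd> G \<Longrightarrow> normal_closure G S \<subseteq> N"
  unfolding normal_closure_def by (rule hull_minimal)


section \<open>Group presentations\<close>

text \<open>
  Words over the alphabet \<open>'a\<close>: the letter \<open>(x, True)\<close> stands for the generator \<open>x\<close>,
  and \<open>(x, False)\<close> for its formal inverse.
\<close>

type_synonym 'a word = "('a \<times> bool) list"

inductive cancels :: "'a word \<Rightarrow> 'a word \<Rightarrow> bool"
  where "cancels (u @ (x, e) # (x, \<not> e) # v) (u @ v)"

definition word_rel :: "('a word \<times> 'a word) set"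
  where "word_rel = {(u, v). equivclp cancels u v}"

definition word_class :: "'a word \<Rightarrow> 'a word set"
  where "word_class w = word_rel `` {w}"

text \<open>The free group on the set of all elements of the type \<open>'a\<close>.\<close>

definition free_group :: "'a word set monoid"
  where "free_group =
    \<lparr>carrier = UNIV // word_rel,
     mult = (\<lambda>U V. \<Union>u\<in>U. \<Union>v\<in>V. word_class (u @ v)),
     one = word_class []\<rparr>"

definition free_gen :: "'a \<Rightarrow> 'a word set"
  where "free_gen x = word_class [(x, True)]"

definition presented_group :: "'a word set set \<Rightarrow> 'a word set set monoid"
  where "presented_group R = free_group Mod normal_closure free_group R"

lemma equiv_word_rel: "equiv UNIV word_rel"
proof (rule equivI)
  show "sym word_rel" unfolding word_rel_def by (auto intro: symI equivclp_sym)
  show "trans word_rel"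
    by (rule transI) (simp add: word_rel_def, erule (1) equivclp_trans)
qed (auto simp: word_rel_def refl_on_def)

lemma word_class_eq_iff: "word_class u = word_class v \<longleftrightarrow> (u, v) \<in> word_rel"
  unfolding word_class_def using eq_equiv_class_iff[OF equiv_word_rel] by blast

lemma cancels_append: "cancels u v \<Longrightarrow> cancels (p @ u @ q) (p @ v @ q)"
proof (induction rule: cancels.induct)
  case (1 u x e v)
  show ?case using cancels.intros[of "p @ u" x e "v @ q"] by simp
qed

lemma word_rel_append:
  assumes "(u, v) \<in> word_rel"
  shows "(p @ u @ q, p @ v @ q) \<in> word_rel"
proof -
  have "equivclp cancels u v" using assms by (simp add: word_rel_def)
  then have "equivclp cancels (p @ u @ q) (p @ v @ q)"
    by (induction rule: equivclp_induct)
      (simp, metis cancels_append equivclp_into_equivclp)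
  then show ?thesis by (simp add: word_rel_def)
qed

lemma word_rel_append2:
  assumes "(u, u') \<in> word_rel" "(v, v') \<in> word_rel"
  shows "(u @ v, u' @ v') \<in> word_rel"
proof -
  have "(u @ v, u' @ v) \<in> word_rel" using word_rel_append[OF assms(1), of "[]" v] by simp
  moreover have "(u' @ v, u' @ v') \<in> word_rel"
    using word_rel_append[OF assms(2), of u' "[]"] by simp
  ultimately show ?thesis
    using equiv_word_rel by (meson equivE transD)
qed

lemma carrier_free_group: "carrier free_group = range word_class"
  by (auto simp: free_group_def quotient_def word_class_def)

lemma one_free_group: "\<one>\<^bsub>free_group\<^esub> = word_class []"
  by (simp add: free_group_def)

lemma mult_free_group: "word_class u \<otimes>\<^bsub>free_group\<^esub> word_class v = word_class (u @ v)"
proof -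
  have self: "w \<in> word_class w" for w :: "'a word"
    by (simp add: word_class_def word_rel_def)
  have mult: "word_class u \<otimes>\<^bsub>free_group\<^esub> word_class v =
      (\<Union>u'\<in>word_class u. \<Union>v'\<in>word_class v. word_class (u' @ v'))"
    by (simp add: free_group_def)
  have "word_class (u' @ v') = word_class (u @ v)"
    if "u' \<in> word_class u" "v' \<in> word_class v" for u' v'
  proof -
    have "(u @ v, u' @ v') \<in> word_rel"
      by (rule word_rel_append2) (use that in \<open>simp_all add: word_class_def\<close>)
    then show ?thesis by (metis word_class_eq_iff)
  qed
  then have "word_class u \<otimes>\<^bsub>free_group\<^esub> word_class v =
      (\<Union>u'\<in>word_class u. \<Union>v'\<in>word_class v. word_class (u @ v))"
    unfolding mult by simp
  then show ?thesis using self[of u] self[of v] by blast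
qed

lemma word_class_left_inverse:
  "word_class (map (\<lambda>(x, e). (x, \<not> e)) (rev w) @ w) = word_class []"
proof (induction w)
  case Nil
  show ?case by simp
next
  case (Cons l w)
  obtain x e where l: "l = (x, e)" by (cases l)
  let ?i = "map (\<lambda>(x, e). (x, \<not> e)) (rev w)"
  have "cancels (?i @ (x, \<not> e) # (x, \<not> \<not> e) # w) (?i @ w)" by (rule cancels.intros)
  then have "(map (\<lambda>(x, e). (x, \<not> e)) (rev (l # w)) @ l # w, ?i @ w) \<in> word_rel"
    by (auto simp: l word_rel_def)
  then show ?case using Cons word_class_eq_iff by metis
qed

lemma group_free_group: "group free_group"
proof (rule groupI)
  fix U :: "'a word set"
  assume "U \<in> carrier free_group"
  then obtain u where "U = word_class u" by (auto simp: carrier_free_group)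
  then show "\<exists>V\<in>carrier free_group. V \<otimes>\<^bsub>free_group\<^esub> U = \<one>\<^bsub>free_group\<^esub>"
    using word_class_left_inverse[of u]
    by (auto simp: carrier_free_group mult_free_group one_free_group)
qed (auto simp: carrier_free_group mult_free_group one_free_group)

lemma free_gen_in_carrier: "free_gen x \<in> carrier free_group"
  by (auto simp: free_gen_def carrier_free_group)

lemma group_presented_group:
  assumes "R \<subseteq> carrier free_group"
  shows "group (presented_group R)"
  unfolding presented_group_def
  by (intro normal.factorgroup_is_group group.normal_closure_normal group_free_group assms)


section \<open>The Baumslag-Solitar groups \<open>BS(1, n)\<close>\<close>

datatype bs_gen = gen_a | gen_b

definition bs_relator :: "int \<Rightarrow> bs_gen word set"
  where "bs_relator n =
    free_gen gen_b \<otimes>\<^bsub>free_group\<^esub> free_gen gen_a \<otimes>\<^bsub>free_group\<^esub> inv\<^bsub>free_group\<^esub> free_gen gen_b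
      \<otimes>\<^bsub>free_group\<^esub> inv\<^bsub>free_group\<^esub> (free_gen gen_a [^]\<^bsub>free_group\<^esub> n)"

definition BS1 :: "int \<Rightarrow> bs_gen word set set monoid"
  where "BS1 n = presented_group {bs_relator n}"

lemma bs_relator_in_carrier: "bs_relator n \<in> carrier free_group"
proof -
  interpret group "free_group :: bs_gen word set monoid" by (rule group_free_group)
  show ?thesis unfolding bs_relator_def by (intro m_closed inv_closed int_pow_closed free_gen_in_carrier)
qed

lemma group_BS1: "group (BS1 n)"
  unfolding BS1_def by (intro group_presented_group) (simp add: bs_relator_in_carrier)

end

theory Submission
  imports Defs Complex_Main
begin

text \<open>
  Sending \<open>a\<close> to \<open>x \<mapsto> x + 1\<close> and \<open>b\<close> to \<open>x \<mapsto> n x\<close> embeds \<open>BS(1, n)\<close> into the group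
  \<open>\<int>[1/n] \<rtimes> \<int>\<close> of affine maps; injectivity follows from the normal form \<open>b\<^sup>-\<^sup>i a\<^sup>k b\<^sup>j\<close>.
  For even \<open>m > 0\<close>, the pairs \<open>(r, k)\<close> with \<open>n\<^sup>m - 1\<close> dividing \<open>r\<close> and \<open>m\<close> dividing \<open>k\<close> form a normal
  subgroup \<open>N\<^sub>m\<close>, which contains the centralizer of \<open>(n\<^sup>m - 1, 2m)\<close> and therefore also its normal closure.
  Hence the pseudocentre lies in the intersection of all \<open>N\<^sub>m\<close>, which is trivial.
\<close>

section \<open>Homomorphisms out of presented groups\<close>

definition eval_letter :: "('g, 'm) monoid_scheme \<Rightarrow> ('a \<Rightarrow> 'g) \<Rightarrow> 'a \<times> bool \<Rightarrow> 'g"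
  where "eval_letter G f l = (if snd l then f (fst l) else inv\<^bsub>G\<^esub> f (fst l))"

definition eval_word :: "('g, 'm) monoid_scheme \<Rightarrow> ('a \<Rightarrow> 'g) \<Rightarrow> 'a word \<Rightarrow> 'g"
  where "eval_word G f w = foldr (\<lambda>l g. eval_letter G f l \<otimes>\<^bsub>G\<^esub> g) w \<one>\<^bsub>G\<^esub>"

lemma eval_word_Nil [simp]: "eval_word G f [] = \<one>\<^bsub>G\<^esub>"
  by (simp add: eval_word_def)

lemma eval_word_Cons [simp]: "eval_word G f (l # w) = eval_letter G f l \<otimes>\<^bsub>G\<^esub> eval_word G f w"
  by (simp add: eval_word_def)

context group
begin

lemma eval_letter_closed: "range f \<subseteq> carrier G \<Longrightarrow> eval_letter G f l \<in> carrier G"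
  by (auto simp: eval_letter_def)

lemma eval_word_closed: "range f \<subseteq> carrier G \<Longrightarrow> eval_word G f w \<in> carrier G"
  by (induction w) (simp_all add: eval_letter_closed)

lemma eval_word_append:
  assumes "range f \<subseteq> carrier G"
  shows "eval_word G f (u @ v) = eval_word G f u \<otimes> eval_word G f v"
  by (induction u) (simp_all add: assms eval_letter_closed eval_word_closed m_assoc)

lemma eval_word_cancels:
  assumes f: "range f \<subseteq> carrier G" and "cancels u v"
  shows "eval_word G f u = eval_word G f v"
  using assms(2)
proof cases
  case (1 p x e q)
  have "f x \<in> carrier G" using f by auto
  then have "eval_letter G f (x, e) \<otimes> (eval_letter G f (x, \<not> e) \<otimes> eval_word G f q) = eval_word G f q"
    using eval_word_closed[OF f, of q] by (cases e) (simp_all add: eval_letter_def flip: m_assoc)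
  then show ?thesis by (simp add: 1 eval_word_append[OF f])
qed

lemma eval_word_class:
  assumes f: "range f \<subseteq> carrier G" and "word_class u = word_class v"
  shows "eval_word G f u = eval_word G f v"
proof -
  have "equivclp cancels u v" using assms(2) by (simp add: word_class_eq_iff word_rel_def)
  then show ?thesis
    by (induction rule: equivclp_induct) (auto dest: eval_word_cancels[OF f])
qed

lemma free_group_universal:
  assumes f: "range f \<subseteq> carrier G"
  obtains h where "h \<in> hom free_group G" "\<And>x. h (free_gen x) = f x"
proof
  \<comment> \<open>\<open>SOME\<close> picks an arbitrary representative word; by
    \<open>eval_word_class\<close> the value does not depend on this choice.\<close>
  define h where "h U = eval_word G f (SOME u. U = word_class u)" for U
  have h: "h (word_class u) = eval_word G f u" for u
    unfolding h_def by (rule eval_word_class[OF f]) (metis (mono_tags, lifting) someI_ex)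
  show "h \<in> hom free_group G"
    by (rule homI)
      (auto simp: carrier_free_group mult_free_group h eval_word_append[OF f] eval_word_closed[OF f])
  show "h (free_gen x) = f x" for x
    using f by (auto simp: free_gen_def h eval_letter_def image_subset_iff)
qed

end

section \<open>Generators, universal property and induction for presented groups\<close>

definition presented_gen :: "'a word set set \<Rightarrow> 'a \<Rightarrow> 'a word set set"
  where "presented_gen R x = normal_closure free_group R #>\<^bsub>free_group\<^esub> free_gen x"

context
  fixes R :: "'a word set set"
  assumes R: "R \<subseteq> carrier free_group"
begin

interpretation F: group "free_group :: 'a word set monoid" by (rule group_free_group)

interpretation N: normal "normal_closure free_group R" free_group
  by (rule F.normal_closure_normal[OF R])

interpretation Q: group "presented_group R" by (rule group_presented_group[OF R])

lemma presented_group_projection: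
  "(\<lambda>u. normal_closure free_group R #>\<^bsub>free_group\<^esub> u) \<in> hom free_group (presented_group R)"
  unfolding presented_group_def by (rule N.r_coset_hom_Mod)

interpretation p: group_hom free_group "presented_group R" "\<lambda>u. normal_closure free_group R #>\<^bsub>free_group\<^esub> u"
  by unfold_locales (rule presented_group_projection)

lemma presented_gen_closed: "presented_gen R x \<in> carrier (presented_group R)"
  unfolding presented_gen_def by (rule p.hom_closed[OF free_gen_in_carrier])

lemma presented_relator:
  assumes "r \<in> R"
  shows "normal_closure free_group R #>\<^bsub>free_group\<^esub> r = \<one>\<^bsub>presented_group R\<^esub>"
proof -
  have "r \<in> normal_closure free_group R" using subset_normal_closure assms by (rule subsetD)
  then show ?thesis
    using F.coset_join2[OF N.mem_carrier N.subgroup_axioms] by (simp add: presented_group_def)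
qed

text \<open>Von Dyck's theorem: the kernel of \<open>h\<close> is normal and contains
  \<open>R\<close>, hence contains the normal closure of \<open>R\<close>, so \<open>h\<close> is
  constant on its cosets.\<close>

lemma presented_group_universal:
  assumes H: "group H" and h: "h \<in> hom free_group H" and one: "\<And>r. r \<in> R \<Longrightarrow> h r = \<one>\<^bsub>H\<^esub>"
  obtains k where "k \<in> hom (presented_group R) H" "\<And>x. k (presented_gen R x) = h (free_gen x)"
proof -
  interpret h: group_hom free_group H h
    using H h by (simp add: group_hom_def group_hom_axioms_def F.group_axioms)
  have "R \<subseteq> kernel free_group H h" using R one by (auto simp: kernel_def)
  then have ker: "normal_closure free_group R \<subseteq> kernel free_group H h"
    by (rule normal_closure_minimal[OF _ h.normal_kernel])
  have eq: "h u = h v"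
    if u: "u \<in> carrier free_group" and v: "v \<in> carrier free_group"
      and uv: "normal_closure free_group R #>\<^bsub>free_group\<^esub> u = normal_closure free_group R #>\<^bsub>free_group\<^esub> v" for u v
  proof -
    have "u \<in> normal_closure free_group R #>\<^bsub>free_group\<^esub> v"
      using F.rcos_self[OF u N.subgroup_axioms] uv by simp
    then obtain c where c: "c \<in> normal_closure free_group R" "u = c \<otimes>\<^bsub>free_group\<^esub> v"
      by (auto simp: r_coset_def)
    then have "c \<in> carrier free_group" "h c = \<one>\<^bsub>H\<^esub>" using ker by (auto simp: kernel_def)
    then show ?thesis using c(2) v by simp
  qed
  obtain k where "k \<in> hom (presented_group R) H"
    "\<And>u. u \<in> carrier free_group \<Longrightarrow> k (normal_closure free_group R #>\<^bsub>free_group\<^esub> u) = h u"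
    using FactGroup_universal[OF h N.normal_axioms eq] unfolding presented_group_def by blast
  then show thesis
    using that by (simp add: presented_gen_def free_gen_in_carrier)
qed

text \<open>Every element is the coset of the class of some word, so this is induction on that word,
  one letter being prepended at a time.\<close>

lemma presented_group_induct [consumes 1, case_names one gen inv_gen]:
  assumes g: "g \<in> carrier (presented_group R)"
    and one: "P \<one>\<^bsub>presented_group R\<^esub>"
    and gen: "\<And>x g. g \<in> carrier (presented_group R) \<Longrightarrow> P g \<Longrightarrow>
      P (presented_gen R x \<otimes>\<^bsub>presented_group R\<^esub> g)"
    and inv_gen: "\<And>x g. g \<in> carrier (presented_group R) \<Longrightarrow> P g \<Longrightarrow>
      P (inv\<^bsub>presented_group R\<^esub> presented_gen R x \<otimes>\<^bsub>presented_group R\<^esub> g)"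
  shows "P g"
proof -
  let ?p = "\<lambda>w. normal_closure free_group R #>\<^bsub>free_group\<^esub> word_class w"
  have closed: "?p w \<in> carrier (presented_group R)" for w
    by (rule p.hom_closed) (simp add: carrier_free_group)
  have mult: "?p (u @ v) = ?p u \<otimes>\<^bsub>presented_group R\<^esub> ?p v" for u v
    by (simp add: carrier_free_group flip: mult_free_group p.hom_mult)
  have one': "?p [] = \<one>\<^bsub>presented_group R\<^esub>"
    using p.hom_one by (simp add: one_free_group)
  have gen_True: "?p [(x, True)] = presented_gen R x" for x
    by (simp add: presented_gen_def free_gen_def)
  have gen_False: "?p [(x, False)] = inv\<^bsub>presented_group R\<^esub> presented_gen R x" for x
  proof (rule sym, rule Q.inv_equality)
    have "?p [(x, False)] \<otimes>\<^bsub>presented_group R\<^esub> ?p [(x, True)] = ?p ([(x, False)] @ [(x, True)])"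
      by (rule mult[symmetric])
    also have "\<dots> = ?p []" using word_class_left_inverse[of "[(x, True)]"] by simp
    finally show "?p [(x, False)] \<otimes>\<^bsub>presented_group R\<^esub> presented_gen R x = \<one>\<^bsub>presented_group R\<^esub>"
      by (simp add: gen_True one')
  qed (simp_all add: closed presented_gen_closed)
  have "P (?p w)" for w
  proof (induction w)
    case Nil
    show ?case using one by (simp add: one')
  next
    case (Cons l w)
    obtain x e where "l = (x, e)" by (cases l)
    then show ?case
      using mult[of "[l]" w] gen[OF closed Cons] inv_gen[OF closed Cons]
      by (cases e) (simp_all add: gen_True gen_False)
  qed
  moreover obtain w where "g = ?p w"
    using g by (auto simp: presented_group_def carrier_FactGroup carrier_free_group)
  ultimately show ?thesis by simp
qed

end

section \<open>Normal forms in \<open>BS(1, n)\<close>\<close>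

lemma singleton_bs_relator_subset: "{bs_relator n} \<subseteq> carrier free_group"
  by (simp add: bs_relator_in_carrier)

lemmas BS1_induct [consumes 1, case_names one gen inv_gen] =
  presented_group_induct[OF singleton_bs_relator_subset, folded BS1_def]

abbreviation bs_elt :: "int \<Rightarrow> bs_gen \<Rightarrow> bs_gen word set set"
  where "bs_elt n \<equiv> presented_gen {bs_relator n}"

lemma bs_elt_closed: "bs_elt n x \<in> carrier (BS1 n)"
  unfolding BS1_def by (rule presented_gen_closed[OF singleton_bs_relator_subset])

text \<open>The coset of the relator is trivial, and the resulting equation is solved for
  \<open>b a\<close>. In this form it says how \<open>b\<close> moves to the right past
  \<open>a\<close>.\<close>

lemma bs_relation:
  "bs_elt n gen_b \<otimes>\<^bsub>BS1 n\<^esub> bs_elt n gen_a = bs_elt n gen_a [^]\<^bsub>BS1 n\<^esub> n \<otimes>\<^bsub>BS1 n\<^esub> bs_elt n gen_b"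
proof -
  let ?R = "{bs_relator n}" and ?F = "free_group :: bs_gen word set monoid"
  note R = singleton_bs_relator_subset[of n]
  interpret B: group "BS1 n" by (rule group_BS1)
  interpret F: group ?F by (rule group_free_group)
  define N where "N = normal_closure free_group ?R"
  interpret p: group_hom ?F "BS1 n" "\<lambda>u. N #>\<^bsub>?F\<^esub> u"
    using presented_group_projection[OF R] by unfold_locales (simp add: BS1_def N_def)
  define \<alpha> \<beta> where "\<alpha> = bs_elt n gen_a" and "\<beta> = bs_elt n gen_b"
  have [simp]: "N #>\<^bsub>?F\<^esub> free_gen gen_a = \<alpha>" "N #>\<^bsub>?F\<^esub> free_gen gen_b = \<beta>"
    by (simp_all add: \<alpha>_def \<beta>_def presented_gen_def N_def)
  have [simp]: "\<alpha> \<in> carrier (BS1 n)" "\<beta> \<in> carrier (BS1 n)"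
    by (simp_all add: \<alpha>_def \<beta>_def bs_elt_closed)
  have "\<one>\<^bsub>BS1 n\<^esub> = N #>\<^bsub>?F\<^esub> bs_relator n"
    using presented_relator[OF R] by (simp add: BS1_def N_def)
  also have "\<dots> = \<beta> \<otimes>\<^bsub>BS1 n\<^esub> \<alpha> \<otimes>\<^bsub>BS1 n\<^esub> inv\<^bsub>BS1 n\<^esub> \<beta> \<otimes>\<^bsub>BS1 n\<^esub> inv\<^bsub>BS1 n\<^esub> (\<alpha> [^]\<^bsub>BS1 n\<^esub> n)"
    by (simp add: bs_relator_def p.hom_int_pow free_gen_in_carrier)
  finally have "\<beta> \<otimes>\<^bsub>BS1 n\<^esub> \<alpha> \<otimes>\<^bsub>BS1 n\<^esub> inv\<^bsub>BS1 n\<^esub> \<beta> = \<alpha> [^]\<^bsub>BS1 n\<^esub> n"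
    by (simp add: B.inv_solve_right)
  then have "\<beta> \<otimes>\<^bsub>BS1 n\<^esub> \<alpha> = \<alpha> [^]\<^bsub>BS1 n\<^esub> n \<otimes>\<^bsub>BS1 n\<^esub> \<beta>"
    by (simp add: B.inv_solve_right')
  then show ?thesis by (simp add: \<alpha>_def \<beta>_def)
qed

section \<open>Moving powers past each other in any group with two elements satisfying the
  Baumslag-Solitar relation\<close>

context group
begin

lemma swap_inv:
  assumes eq: "x \<otimes> y = z \<otimes> x" and [simp]: "x \<in> carrier G" "y \<in> carrier G" "z \<in> carrier G"
  shows "y \<otimes> inv x = inv x \<otimes> z"
proof -
  have "y \<otimes> inv x = inv x \<otimes> (x \<otimes> y) \<otimes> inv x" by (simp flip: m_assoc)
  also have "\<dots> = inv x \<otimes> z" by (simp add: eq m_assoc)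
  finally show ?thesis .
qed

text \<open>Conjugation by \<beta> is an endomorphism, so it commutes with integer powers, negative
  ones included.\<close>

lemma conj_int_pow:
  assumes [simp]: "\<alpha> \<in> carrier G" "\<beta> \<in> carrier G" and rel: "\<beta> \<otimes> \<alpha> = \<alpha> [^] n \<otimes> \<beta>"
  shows "\<beta> \<otimes> \<alpha> [^] (k :: int) = \<alpha> [^] (n * k) \<otimes> \<beta>"
proof -
  have "group_hom G G (\<lambda>g. \<beta> \<otimes> g \<otimes> inv \<beta>)"
    by unfold_locales (auto intro!: homI simp: m_assoc, metis (no_types, lifting) assms(2) inv_closed l_inv l_one m_assoc m_closed)
  then have "\<beta> \<otimes> \<alpha> [^] k \<otimes> inv \<beta> = (\<beta> \<otimes> \<alpha> \<otimes> inv \<beta>) [^] k"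
    using group_hom.hom_int_pow assms(1) by fastforce
  also have "\<dots> = \<alpha> [^] (n * k)"
    by (simp add: rel m_assoc int_pow_pow)
  finally show ?thesis by (metis assms(1,2) int_pow_closed inv_closed inv_solve_right m_closed)
qed

text \<open>The exponent \<open>i\<close> is natural because conjugation by the inverse of \<beta>
  need not send \<alpha> to a power of \<alpha>.\<close>

lemma conj_int_pow_pow:
  assumes [simp]: "\<alpha> \<in> carrier G" "\<beta> \<in> carrier G" and rel: "\<beta> \<otimes> \<alpha> = \<alpha> [^] n \<otimes> \<beta>"
  shows "\<beta> [^] (i :: nat) \<otimes> \<alpha> [^] (k :: int) = \<alpha> [^] (n ^ i * k) \<otimes> \<beta> [^] i"
proof (induction i)
  case (Suc i)
  have "\<beta> [^] Suc i \<otimes> \<alpha> [^] k = \<beta> \<otimes> \<alpha> [^] (n ^ i * k) \<otimes> \<beta> [^] i"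
    by (simp only: nat_pow_Suc2 assms m_assoc nat_pow_closed int_pow_closed Suc.IH)
  also have "\<dots> = \<alpha> [^] (n ^ Suc i * k) \<otimes> (\<beta> \<otimes> \<beta> [^] i)"
    by (simp add: conj_int_pow[OF assms] m_assoc mult.assoc)
  also have "\<beta> \<otimes> \<beta> [^] i = \<beta> [^] Suc i" by (simp only: nat_pow_Suc2 assms)
  finally show ?case .
qed simp

end

text \<open>The elements of this form include the identity and are closed under left multiplication
  by both generators and their inverses, so induction over words reaches the whole group.\<close>

lemma BS1_normal_form:
  assumes "g \<in> carrier (BS1 n)"
  shows "\<exists>(i :: nat) (k :: int) (j :: int). g =
    inv\<^bsub>BS1 n\<^esub> (bs_elt n gen_b [^]\<^bsub>BS1 n\<^esub> i) \<otimes>\<^bsub>BS1 n\<^esub> (bs_elt n gen_a [^]\<^bsub>BS1 n\<^esub> k \<otimes>\<^bsub>BS1 n\<^esub> bs_elt n gen_b [^]\<^bsub>BS1 n\<^esub> j)"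
proof -
  interpret group "BS1 n" by (rule group_BS1)
  define \<alpha> \<beta> where "\<alpha> = bs_elt n gen_a" and "\<beta> = bs_elt n gen_b"
  note [simp] = bs_elt_closed[of n gen_a, folded \<alpha>_def] bs_elt_closed[of n gen_b, folded \<beta>_def]
  have rel: "\<beta> \<otimes>\<^bsub>BS1 n\<^esub> \<alpha> = \<alpha> [^]\<^bsub>BS1 n\<^esub> n \<otimes>\<^bsub>BS1 n\<^esub> \<beta>"
    using bs_relation by (simp add: \<alpha>_def \<beta>_def)
  define nf where "nf i k j = inv\<^bsub>BS1 n\<^esub> (\<beta> [^]\<^bsub>BS1 n\<^esub> i) \<otimes>\<^bsub>BS1 n\<^esub> (\<alpha> [^]\<^bsub>BS1 n\<^esub> k \<otimes>\<^bsub>BS1 n\<^esub> \<beta> [^]\<^bsub>BS1 n\<^esub> j)"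
    for i :: nat and k j :: int
  \<comment> \<open>A power of \<open>a\<close> passes the leading inverse power of
    \<open>b\<close>, its exponent being multiplied by \<open>n ^ i\<close>, and merges with the
    power of \<open>a\<close> behind it.\<close>
  have a: "\<alpha> [^]\<^bsub>BS1 n\<^esub> l \<otimes>\<^bsub>BS1 n\<^esub> nf i k j = nf i (n ^ i * l + k) j" for l i k j
  proof -
    have "\<alpha> [^]\<^bsub>BS1 n\<^esub> l \<otimes>\<^bsub>BS1 n\<^esub> inv\<^bsub>BS1 n\<^esub> (\<beta> [^]\<^bsub>BS1 n\<^esub> i) =
        inv\<^bsub>BS1 n\<^esub> (\<beta> [^]\<^bsub>BS1 n\<^esub> i) \<otimes>\<^bsub>BS1 n\<^esub> \<alpha> [^]\<^bsub>BS1 n\<^esub> (n ^ i * l)"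
      using conj_int_pow_pow[OF _ _ rel, of i l] by (intro swap_inv) simp_all
    then show ?thesis
      by (simp add: nf_def int_pow_mult m_assoc flip: m_assoc[of "\<alpha> [^]\<^bsub>BS1 n\<^esub> l"])
  qed
  have a_one: "\<alpha> \<otimes>\<^bsub>BS1 n\<^esub> nf i k j = nf i (n ^ i + k) j"
    and a_inv: "inv\<^bsub>BS1 n\<^esub> \<alpha> \<otimes>\<^bsub>BS1 n\<^esub> nf i k j = nf i (- (n ^ i) + k) j" for i k j
    using a[of 1 i k j] a[of "- 1" i k j] by (simp_all add: int_pow_neg)
  \<comment> \<open>For positive \<open>i\<close> the factor \<beta> cancels against the leading
    inverse power. For \<open>i = 0\<close> it has to travel past the power of \<alpha> and joins
    the power of \<beta> on the right.\<close>
  have b: "\<exists>i' k' j'. \<beta> \<otimes>\<^bsub>BS1 n\<^esub> nf i k j = nf i' k' j'" for i k j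
  proof (cases i)
    case 0
    have "\<beta> \<otimes>\<^bsub>BS1 n\<^esub> nf i k j = nf 0 (n * k) (1 + j)"
      using conj_int_pow[OF _ _ rel, of k]
      by (simp add: nf_def 0 int_pow_mult flip: m_assoc)
    then show ?thesis by blast
  next
    case (Suc i')
    have "\<beta> \<otimes>\<^bsub>BS1 n\<^esub> nf i k j = nf i' k j"
      by (simp add: nf_def Suc inv_mult_group flip: m_assoc)
    then show ?thesis by blast
  qed
  have b': "inv\<^bsub>BS1 n\<^esub> \<beta> \<otimes>\<^bsub>BS1 n\<^esub> nf i k j = nf (Suc i) k j" for i k j
    by (simp add: nf_def nat_pow_Suc2 inv_mult_group m_assoc flip: nat_pow_Suc2)
  have "\<exists>i k j. g = nf i k j"
    using assms
  proof (induction rule: BS1_induct)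
    case one
    have "\<one>\<^bsub>BS1 n\<^esub> = nf 0 0 0" by (simp add: nf_def)
    then show ?case by blast
  next
    case (gen x g)
    then obtain i k j where "g = nf i k j" by blast
    then show ?case using b[of i k j] a_one[of i k j] by (cases x) (auto simp: \<alpha>_def \<beta>_def)
  next
    case (inv_gen x g)
    then obtain i k j where "g = nf i k j" by blast
    then show ?case using b'[of i k j] a_inv[of i k j]
      by (cases x) (auto simp: \<alpha>_def \<beta>_def)
  qed
  then show ?thesis by (simp add: nf_def \<alpha>_def \<beta>_def)
qed


section \<open>The affine group over \<open>\<int>[1/n]\<close>\<close>

definition localization :: "int \<Rightarrow> rat set"
  where "localization n = {r. \<exists>e :: nat. r * of_int n ^ e \<in> \<int>}"

lemma Ints_localization: "r \<in> \<int> \<Longrightarrow> r \<in> localization n"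
  unfolding localization_def by (auto intro: exI[of _ 0])

lemma localization_add:
  assumes "r \<in> localization n" "s \<in> localization n"
  shows "r + s \<in> localization n"
proof -
  obtain d e where "r * of_int n ^ d \<in> \<int>" "s * of_int n ^ e \<in> \<int>"
    using assms by (auto simp: localization_def)
  then have "r * of_int n ^ d * of_int n ^ e + s * of_int n ^ e * of_int n ^ d \<in> \<int>" by simp
  also have "r * of_int n ^ d * of_int n ^ e + s * of_int n ^ e * of_int n ^ d = (r + s) * of_int n ^ (d + e)" by (simp add: algebra_simps power_add)
  finally show ?thesis unfolding localization_def by blast
qed

lemma localization_mult:
  assumes "r \<in> localization n" "s \<in> localization n"
  shows "r * s \<in> localization n"
proof -
  obtain d e where "r * of_int n ^ d \<in> \<int>" "s * of_int n ^ e \<in> \<int>"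
    using assms by (auto simp: localization_def)
  then have "(r * of_int n ^ d) * (s * of_int n ^ e) \<in> \<int>" by (rule Ints_mult)
  also have "(r * of_int n ^ d) * (s * of_int n ^ e) = (r * s) * of_int n ^ (d + e)" by (simp add: algebra_simps power_add)
  finally show ?thesis unfolding localization_def by blast
qed

lemma localization_uminus: "r \<in> localization n \<Longrightarrow> - r \<in> localization n"
  using localization_mult[OF Ints_localization[of "- 1"]] by simp

lemma localization_diff: "r \<in> localization n \<Longrightarrow> s \<in> localization n \<Longrightarrow> r - s \<in> localization n"
  using localization_add[OF _ localization_uminus] by fastforce

lemma localization_powi:
  assumes "n \<noteq> 0"
  shows "of_int n powi k \<in> localization n"
proof (cases "k \<ge> 0")
  case True
  then show ?thesis by (simp add: Ints_localization power_int_def)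
next
  case False
  then have "of_int n powi k * (of_int n :: rat) ^ nat (- k) = 1"
    using assms by (simp add: power_int_def flip: power_mult_distrib)
  then show ?thesis unfolding localization_def by (auto intro!: exI[of _ "nat (- k)"])
qed

text \<open>Clearing the denominator gives \<open>u * n ^ e = d * z\<close>, and coprimality removes
  the power of \<open>n\<close>. This turns membership in Z[1/n] into divisibility of
  integers.\<close>

lemma dvd_of_localization:
  assumes "coprime d n" "d \<noteq> 0" "of_int u / of_int d \<in> localization n"
  shows "d dvd u"
proof -
  obtain e z where "of_int u / of_int d * of_int n ^ e = (of_int z :: rat)"
    using assms(3) by (auto simp: localization_def elim: Ints_cases)
  then have "(of_int (u * n ^ e) :: rat) = of_int (d * z)"
    using assms(2) by (simp add: field_simps)
  then have "d dvd u * n ^ e" by (simp only: of_int_eq_iff) simp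
  then show ?thesis using assms(1) by (simp add: coprime_dvd_mult_left_iff)
qed

text \<open>The pair \<open>(r, k)\<close> stands for the map sending \<open>x\<close> to
  \<open>n^k x + r\<close>, and the product is composition. Recording \<open>k\<close> rather than
  the factor \<open>n^k\<close> gives the semidirect product of Z[1/n] and Z.\<close>

definition affine_group :: "int \<Rightarrow> (rat \<times> int) monoid"
  where "affine_group n =
    \<lparr>carrier = localization n \<times> UNIV,
     mult = (\<lambda>(r, k) (s, l). (r + of_int n powi k * s, k + l)),
     one = (0, 0)\<rparr>"

lemma affine_group_simps [simp]:
  "p \<in> carrier (affine_group n) \<longleftrightarrow> fst p \<in> localization n"
  "(r, k) \<otimes>\<^bsub>affine_group n\<^esub> (s, l) = (r + of_int n powi k * s, k + l)"
  "\<one>\<^bsub>affine_group n\<^esub> = (0, 0)"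
  by (cases p) (simp_all add: affine_group_def)

lemma group_affine_group:
  assumes "n \<noteq> 0"
  shows "group (affine_group n)"
proof (rule groupI)
  fix p assume p: "p \<in> carrier (affine_group n)"
  obtain r k where [simp]: "p = (r, k)" by (cases p)
  have "(- (of_int n powi (- k) * r), - k) \<in> carrier (affine_group n)"
    using p by (simp add: localization_uminus localization_mult localization_powi assms)
  moreover have "(- (of_int n powi (- k) * r), - k) \<otimes>\<^bsub>affine_group n\<^esub> p = \<one>\<^bsub>affine_group n\<^esub>"
    by simp
  ultimately show "\<exists>q\<in>carrier (affine_group n). q \<otimes>\<^bsub>affine_group n\<^esub> p = \<one>\<^bsub>affine_group n\<^esub>"
    by blast
qed (use assms in \<open>auto simp: localization_add localization_mult localization_powi Ints_localization
    power_int_add algebra_simps\<close>)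

lemma affine_group_inv:
  assumes "n \<noteq> 0" "r \<in> localization n"
  shows "inv\<^bsub>affine_group n\<^esub> (r, k) = (- (of_int n powi (- k) * r), - k)"
  using assms
  by (intro group.inv_equality group_affine_group)
    (simp_all add: localization_uminus localization_mult localization_powi)

lemma affine_group_translation_pow:
  assumes "n \<noteq> 0"
  shows "(1, 0) [^]\<^bsub>affine_group n\<^esub> (k :: int) = (of_int k, 0)"
proof -
  have nat: "(1, 0) [^]\<^bsub>affine_group n\<^esub> (i :: nat) = (of_nat i, 0)" for i
    by (induction i) (simp_all)
  show ?thesis
    using assms by (simp add: int_pow_def2 nat affine_group_inv Ints_localization)
qed

lemma affine_group_dilation_pow:
  assumes "n \<noteq> 0"
  shows "(0, 1) [^]\<^bsub>affine_group n\<^esub> (k :: int) = (0, k)"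
proof -
  have nat: "(0, 1) [^]\<^bsub>affine_group n\<^esub> (i :: nat) = (0, int i)" for i
    by (induction i) (simp_all)
  show ?thesis
    using assms by (simp add: int_pow_def2 nat affine_group_inv Ints_localization)
qed

text \<open>The relator is killed because conjugating the translation by 1 with the dilation by
  \<open>n\<close> gives the translation by \<open>n\<close>.\<close>

lemma BS1_hom_affine_group:
  assumes "n \<noteq> 0"
  obtains \<phi> where "\<phi> \<in> hom (BS1 n) (affine_group n)"
    "\<phi> (bs_elt n gen_a) = (1, 0)" "\<phi> (bs_elt n gen_b) = (0, 1)"
proof -
  interpret F: group "free_group :: bs_gen word set monoid" by (rule group_free_group)
  interpret A: group "affine_group n" by (rule group_affine_group[OF assms])
  define f where "f x = (case x of gen_a \<Rightarrow> (1 :: rat, 0 :: int) | gen_b \<Rightarrow> (0, 1))" for x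
  have "range f \<subseteq> carrier (affine_group n)"
    by (auto simp: f_def Ints_localization split: bs_gen.split)
  then obtain h where h: "h \<in> hom free_group (affine_group n)" "\<And>x. h (free_gen x) = f x"
    using A.free_group_universal by blast
  interpret h: group_hom free_group "affine_group n" h
    using h(1) by unfold_locales
  have "h (bs_relator n) = \<one>\<^bsub>affine_group n\<^esub>"
    using assms
    by (simp add: bs_relator_def h.hom_int_pow free_gen_in_carrier h(2) f_def
      affine_group_translation_pow affine_group_inv Ints_localization del: h.hom_one)
  then obtain k where "k \<in> hom (BS1 n) (affine_group n)" "\<And>x. k (bs_elt n x) = h (free_gen x)"
    using presented_group_universal[OF singleton_bs_relator_subset A.group_axioms h(1)]
    unfolding BS1_def by (metis singletonD)
  then show thesis using that by (simp add: h(2) f_def)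
qed

text \<open>The normal form with parameters \<open>i\<close>, \<open>k\<close>, \<open>j\<close> is
  sent to \<open>(n^(-i) k, j - i)\<close>; if this is zero, then \<open>k = 0\<close> and
  \<open>j = i\<close>, and the normal form collapses to the identity.\<close>

lemma BS1_hom_affine_group_trivial_kernel:
  assumes n: "\<bar>n\<bar> \<ge> 2" and \<phi>: "\<phi> \<in> hom (BS1 n) (affine_group n)"
    and a: "\<phi> (bs_elt n gen_a) = (1, 0)" and b: "\<phi> (bs_elt n gen_b) = (0, 1)"
    and g: "g \<in> carrier (BS1 n)" "\<phi> g = (0, 0)"
  shows "g = \<one>\<^bsub>BS1 n\<^esub>"
proof -
  have n0: "n \<noteq> 0" using n by auto
  interpret B: group "BS1 n" by (rule group_BS1)
  interpret A: group "affine_group n" by (rule group_affine_group[OF n0])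
  interpret \<phi>: group_hom "BS1 n" "affine_group n" \<phi> using \<phi> by unfold_locales
  note [simp] = bs_elt_closed[of n]
  obtain i :: nat and k j :: int where nf: "g = inv\<^bsub>BS1 n\<^esub> (bs_elt n gen_b [^]\<^bsub>BS1 n\<^esub> i) \<otimes>\<^bsub>BS1 n\<^esub>
      (bs_elt n gen_a [^]\<^bsub>BS1 n\<^esub> k \<otimes>\<^bsub>BS1 n\<^esub> bs_elt n gen_b [^]\<^bsub>BS1 n\<^esub> j)"
    using BS1_normal_form[OF g(1)] by blast
  have "\<phi> (inv\<^bsub>BS1 n\<^esub> (bs_elt n gen_b [^]\<^bsub>BS1 n\<^esub> i)) = (0, - int i)"
    using affine_group_dilation_pow[OF n0, of "int i"]
    by (simp add: \<phi>.hom_nat_pow b int_pow_int affine_group_inv n0 Ints_localization)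
  then have "(0, 0) = ((of_int n :: rat) powi (- int i) * of_int k, j - int i)"
    using g(2) by (simp add: nf \<phi>.hom_int_pow a b affine_group_translation_pow affine_group_dilation_pow n0)
  then have "k = 0" "j = int i" using n0 by auto
  then show ?thesis by (simp add: nf int_pow_int)
qed

section \<open>Separating normal subgroups\<close>

text \<open>For \<open>q \<ge> 0\<close> the quotient is an integer, by the geometric sum. A
  negative \<open>q\<close> reduces to \<open>-q\<close> through
  \<open>n^(mq) - 1 = - n^(mq) (n^(-mq) - 1)\<close>, where \<open>n^(mq)\<close> lies in
  Z[1/n].\<close>

lemma power_mult_minus_one_div_localization:
  assumes n: "n \<noteq> 0" "n ^ m \<noteq> 1"
  shows "(of_int n powi (int m * q) - 1) / (of_int n ^ m - 1) \<in> localization n"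
proof -
  have nat: "(of_int n powi (int m * int j) - 1) / (of_int n ^ m - 1) \<in> localization n" for j :: nat
  proof -
    have "n ^ m - 1 dvd (n ^ m) ^ j - 1" using power_diff_1_eq[of "n ^ m" j] by simp
    then obtain z where "(n ^ m) ^ j - 1 = (n ^ m - 1) * z" ..
    then have "(of_int ((n ^ m) ^ j - 1) :: rat) = of_int ((n ^ m - 1) * z)" by (rule arg_cong)
    then have "of_int n powi (int m * int j) - 1 = (of_int n ^ m - 1) * (of_int z :: rat)"
      by (simp add: power_mult flip: of_nat_mult)
    moreover have "of_int n ^ m \<noteq> (1 :: rat)" using n(2) by (metis of_int_1 of_int_eq_iff of_int_power)
    ultimately show ?thesis by (simp add: Ints_localization)
  qed
  show ?thesis
  proof (cases "q \<ge> 0")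
    case True
    then show ?thesis using nat[of "nat q"] by simp
  next
    case False
    let ?j = "nat (- q)"
    have "of_int n powi (int m * q) * ((of_int n powi (int m * int ?j) - 1) / (of_int n ^ m - 1)) =
      - ((of_int n powi (int m * q) - 1) / (of_int n ^ m - 1 :: rat))"
      using False n(1) by (simp add: algebra_simps diff_divide_distrib flip: power_int_add)
    then show ?thesis
      using localization_uminus[OF localization_mult[OF localization_powi[OF n(1), of "int m * q"] nat[of ?j]]]
      by simp
  qed
qed

lemma (in group_hom) normal_preimage:
  assumes "N \<lhd> H"
  shows "{g \<in> carrier G. h g \<in> N} \<lhd> G"
proof -
  interpret N: normal N H by (rule assms)
  show ?thesis
    unfolding G.normal_inv_iff
    by (intro conjI ballI G.subgroupI) (auto simp: N.inv_op_closed2 intro: exI[of _ "\<one>"])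
qed

text \<open>For \<open>n ^ m \<noteq> 1\<close> this is the kernel of reducing the first coordinate
  modulo \<open>n ^ m - 1\<close> and the second modulo \<open>m\<close>; the quotient makes sense
  because \<open>n\<close> has \<open>m\<close>-th power 1 modulo \<open>n ^ m - 1\<close>.\<close>

definition congruence_subgroup :: "int \<Rightarrow> nat \<Rightarrow> (rat \<times> int) set"
  where "congruence_subgroup n m =
    {(r, k). int m dvd k \<and> r / (of_int n ^ m - 1) \<in> localization n}"

text \<open>Conjugating \<open>(r, k)\<close> by \<open>(t, l)\<close> gives
  \<open>(n^l r - (n^k - 1) t, k)\<close>. Since \<open>m\<close> divides \<open>k\<close>, the
  factor \<open>n^k - 1\<close> is a multiple of \<open>n ^ m - 1\<close> in Z[1/n].\<close>

lemma congruence_subgroup_normal: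
  assumes n: "n \<noteq> 0" "n ^ m \<noteq> 1"
  shows "congruence_subgroup n m \<lhd> affine_group n"
proof -
  interpret A: group "affine_group n" by (rule group_affine_group[OF n(1)])
  have d: "of_int n ^ m - 1 \<noteq> (0 :: rat)"
    using n(2) by (metis eq_iff_diff_eq_0 of_int_1 of_int_eq_iff of_int_power)
  have sub: "r \<in> localization n" if "r / (of_int n ^ m - 1) \<in> localization n" for r
    using localization_mult[OF that Ints_localization[of "of_int n ^ m - 1"]] d by simp
  show ?thesis
    unfolding A.normal_inv_iff
  proof (intro conjI ballI A.subgroupI)
    show "congruence_subgroup n m \<subseteq> carrier (affine_group n)"
      by (auto simp: congruence_subgroup_def sub)
    have "(0, 0) \<in> congruence_subgroup n m" by (simp add: congruence_subgroup_def Ints_localization)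
    then show "congruence_subgroup n m \<noteq> {}" by blast
    show "inv\<^bsub>affine_group n\<^esub> p \<in> congruence_subgroup n m" if pm: "p \<in> congruence_subgroup n m" for p
    proof -
      obtain r k where p: "p = (r, k)" "int m dvd k" "r / (of_int n ^ m - 1) \<in> localization n"
        using pm by (auto simp: congruence_subgroup_def)
      have "- (of_int n powi (- k) * (r / (of_int n ^ m - 1))) \<in> localization n"
        using p(3) by (intro localization_uminus localization_mult localization_powi n)
      then show ?thesis using p sub by (simp add: affine_group_inv n congruence_subgroup_def)
    qed
    show "p \<otimes>\<^bsub>affine_group n\<^esub> q \<in> congruence_subgroup n m"
      if pm: "p \<in> congruence_subgroup n m" and qm: "q \<in> congruence_subgroup n m" for p q
    proof -
      obtain r k where p: "p = (r, k)" "int m dvd k" "r / (of_int n ^ m - 1) \<in> localization n"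
        using pm by (auto simp: congruence_subgroup_def)
      obtain s l where q: "q = (s, l)" "int m dvd l" "s / (of_int n ^ m - 1) \<in> localization n"
        using qm by (auto simp: congruence_subgroup_def)
      have "r / (of_int n ^ m - 1) + of_int n powi k * (s / (of_int n ^ m - 1)) \<in> localization n"
        using p q by (intro localization_add localization_mult localization_powi n)
      then show ?thesis using p q by (simp add: congruence_subgroup_def add_divide_distrib)
    qed
    show "p \<otimes>\<^bsub>affine_group n\<^esub> q \<otimes>\<^bsub>affine_group n\<^esub> inv\<^bsub>affine_group n\<^esub> p \<in> congruence_subgroup n m"
      if pc: "p \<in> carrier (affine_group n)" and qm: "q \<in> congruence_subgroup n m" for p q
    proof -
      obtain t l where p: "p = (t, l)" "t \<in> localization n" using pc by (cases p) auto
      obtain r k where q: "q = (r, k)" "int m dvd k" "r / (of_int n ^ m - 1) \<in> localization n"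
        using qm by (auto simp: congruence_subgroup_def)
      obtain j where k: "k = int m * j" using q(2) ..
      define w where "w = of_int n powi k - (1 :: rat)"
      have "p \<otimes>\<^bsub>affine_group n\<^esub> q \<otimes>\<^bsub>affine_group n\<^esub> inv\<^bsub>affine_group n\<^esub> p =
          (of_int n powi l * r - w * t, k)"
        using n(1) by (simp add: p q(1) w_def affine_group_inv algebra_simps power_int_add power_int_minus)
      moreover have "of_int n powi l * (r / (of_int n ^ m - 1)) - w / (of_int n ^ m - 1) * t \<in> localization n"
        unfolding w_def k using p q
        by (intro localization_diff localization_mult localization_powi
          power_mult_minus_one_div_localization n)
      ultimately show ?thesis using q(2) by (simp add: congruence_subgroup_def diff_divide_distrib)
    qed
  qed
qed

section \<open>The order of \<open>n\<close> modulo \<open>n ^ m + 1\<close>, and centralizers in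
  the affine group\<close>

lemma two_le_abs_power:
  fixes n :: int
  assumes "\<bar>n\<bar> \<ge> 2" "m > 0"
  shows "\<bar>n ^ m\<bar> \<ge> 2"
proof -
  have "\<bar>n\<bar> ^ 1 \<le> \<bar>n\<bar> ^ m" using assms by (intro power_increasing) auto
  then show ?thesis using assms(1) by (simp add: power_abs)
qed

text \<open>Modulo \<open>n ^ m + 1\<close> the power \<open>n ^ m\<close> is -1, so
  \<open>n ^ r - 1\<close> can be replaced by \<open>n ^ (r - m) + 1\<close> once
  \<open>r \<ge> m\<close>. Either way the number is smaller than the modulus, hence zero, which
  leaves only \<open>r = 0\<close>.\<close>

lemma power_exponent_eq_zero:
  fixes n :: int
  assumes n: "\<bar>n\<bar> \<ge> 2" and m: "even m" "m > 0" and r: "r < 2 * m"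
    and dvd: "n ^ m + 1 dvd n ^ r - 1"
  shows "r = 0"
proof -
  \<comment> \<open>Evenness of \<open>m\<close> matters for negative \<open>n\<close>: it makes the
    modulus equal to \<open>\<bar>n\<bar> ^ m + 1\<close>, which exceeds all the bounds used
    below.\<close>
  have pos: "n ^ m = \<bar>n\<bar> ^ m" using m(1) by (simp add: power_even_abs)
  have small: "x = 0" if "n ^ m + 1 dvd x" "\<bar>x\<bar> \<le> \<bar>n\<bar> ^ i + 1" "i < m" for x i
  proof -
    have "\<bar>n\<bar> ^ i < \<bar>n\<bar> ^ m" using n that(3) by (simp add: power_strict_increasing)
    then have "\<bar>x\<bar> < \<bar>n ^ m + 1\<bar>" using that(2) pos by linarith
    then show ?thesis using dvd_imp_le_int[OF _ that(1)] by linarith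
  qed
  show ?thesis
  proof (cases "r < m")
    case True
    have "\<bar>n ^ r - 1\<bar> \<le> \<bar>n\<bar> ^ r + 1" using abs_triangle_ineq4[of "n ^ r" 1] by (simp add: power_abs)
    then have "n ^ r - 1 = 0" using small[OF dvd _ True] by blast
    then show ?thesis using two_le_abs_power[OF n, of r] by (cases "r = 0") auto
  next
    case False
    define i where "i = r - m"
    have "n ^ i + 1 = n ^ i * (n ^ m + 1) - (n ^ r - 1)"
    proof -
      have "r = i + m" using False by (simp add: i_def)
      then show ?thesis by (simp add: power_add distrib_left)
    qed
    then have "n ^ m + 1 dvd n ^ i + 1" using dvd_diff[OF dvd_triv_right[of _ "n ^ i"] dvd] by (simp only:)
    moreover have "\<bar>n ^ i + 1\<bar> \<le> \<bar>n\<bar> ^ i + 1"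
      using abs_triangle_ineq[of "n ^ i" 1] by (simp add: power_abs)
    moreover have "i < m" using r False by (simp add: i_def)
    ultimately have "n ^ i + 1 = 0" using small by blast
    then show ?thesis using two_le_abs_power[OF n, of i] by (cases "i = 0") auto
  qed
qed

text \<open>
  Commuting forces \<open>s = (n\<^sup>i - 1) / (n\<^sup>m + 1)\<close>, which lies in \<open>\<int>[1/n]\<close> only if \<open>2m\<close> divides \<open>i\<close>, because
  \<open>n\<close> has order \<open>2m\<close> modulo \<open>n\<^sup>m + 1\<close>.
\<close>

lemma commuting_congruence_subgroup:
  assumes n: "\<bar>n\<bar> \<ge> 2" and m: "even m" "m > 0" and s: "s \<in> localization n"
    and comm: "(s, i) \<otimes>\<^bsub>affine_group n\<^esub> (of_int n ^ m - 1, int (2 * m)) =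
      (of_int n ^ m - 1, int (2 * m)) \<otimes>\<^bsub>affine_group n\<^esub> (s, i)"
  shows "(s, i) \<in> congruence_subgroup n m"
proof -
  have n0: "n \<noteq> 0" using n by auto
  have ne: "n ^ m \<noteq> 1" "n ^ m + 1 \<noteq> 0" "n ^ (2 * m) \<noteq> 1"
    using two_le_abs_power[OF n, of m] two_le_abs_power[OF n, of "2 * m"] m(2) by auto
  define x where "x = (of_int n :: rat) ^ m"
  have x: "x \<noteq> 1" "x + 1 \<noteq> 0"
    using ne unfolding x_def by (metis of_int_1 of_int_eq_iff of_int_power, metis of_int_0 of_int_1 of_int_add of_int_eq_iff of_int_power)
  have xx: "of_int n ^ (2 * m) = x * x" by (simp add: x_def mult_2 power_add)
  have "s + of_int n powi i * (x - 1) = (x - 1) + of_int n powi int (2 * m) * s"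
    using comm by (simp add: x_def del: of_nat_mult)
  then have "s + of_int n powi i * (x - 1) = (x - 1) + x * x * s"
    by (simp only: power_int_of_nat xx)
  \<comment> \<open>The first coordinates of the commutation equation, with \<open>x * x - 1\<close>
    factored so that \<open>x - 1\<close> cancels.\<close>
  then have "(x - 1) * (s * (x + 1) - (of_int n powi i - 1)) = 0" by (simp add: algebra_simps)
  then have "s * (x + 1) = of_int n powi i - 1" using x by simp
  then have s_eq: "s = (of_int n powi i - 1) / (x + 1)" using x by (simp add: eq_divide_eq)
  define q r where "q = i div int (2 * m)" and "r = nat (i mod int (2 * m))"
  have i: "i = int (2 * m) * q + int r" and r: "r < 2 * m"
    using m(2) by (simp_all add: q_def r_def nat_less_iff)
  have quot: "(of_int n powi (int (2 * m) * q) - 1) / (x * x - 1) \<in> localization n" (is "?y \<in> _")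
    using power_mult_minus_one_div_localization[OF n0 ne(3), of q] by (simp only: xx)
  have xx1: "x * x - 1 = (x - 1) * (x + 1)" by (simp add: algebra_simps)
  \<comment> \<open>Subtracting from \<open>s\<close> the contribution of the multiple
    \<open>2 m q\<close> of \<open>2 m\<close> leaves only the remainder \<open>r\<close>, and
    everything subtracted lies in Z[1/n].\<close>
  have "of_int (n ^ r - 1) / of_int (n ^ m + 1) = s - of_int n ^ r * ((x - 1) * ?y)"
  proof -
    define u where "u = (of_int n :: rat) powi (int (2 * m) * q)"
    have "(x - 1) * ?y = (u - 1) / (x + 1)" using x by (simp add: xx1 u_def)
    moreover have "of_int n powi i = u * of_int n ^ r"
      unfolding i u_def using n0 by (simp add: power_int_add)
    ultimately have "s - of_int n ^ r * ((x - 1) * ?y) =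
        (u * of_int n ^ r - 1) / (x + 1) - of_int n ^ r * ((u - 1) / (x + 1))"
      by (simp only: s_eq)
    also have "\<dots> = (of_int n ^ r - 1) / (x + 1)" by (simp add: algebra_simps diff_divide_distrib)
    finally show ?thesis by (simp add: x_def)
  qed
  also have "\<dots> \<in> localization n"
    by (intro localization_diff localization_mult s quot Ints_localization) (simp_all add: x_def)
  finally have "n ^ m + 1 dvd n ^ r - 1"
  proof (rule dvd_of_localization[rotated 2])
    have "coprime (n ^ m + 1) (n ^ m)" by (rule coprime_add_one_left)
    then show "coprime (n ^ m + 1) n" using m(2) by simp
  qed (use ne in simp)
  then have "r = 0" using power_exponent_eq_zero[OF n m r] by blast
  \<comment> \<open>The exponent \<open>2 m\<close> pays off here: \<open>?y\<close> has denominator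
    \<open>(x - 1) * (x + 1)\<close>, so \<open>s\<close> is divisible by \<open>x - 1\<close> as
    well.\<close>
  then have "s / (x - 1) = ?y" "int m dvd i" by (simp_all add: s_eq i xx1 mult.commute)
  then show ?thesis using quot by (simp add: congruence_subgroup_def x_def)
qed

text \<open>For \<open>m\<close> large compared with \<open>k\<close> and with a numerator
  \<open>t\<close> of \<open>r\<close>, the divisibilities of \<open>k\<close> by \<open>m\<close>
  and of \<open>t\<close> by \<open>n ^ m - 1\<close> are possible only for \<open>k = 0\<close> and
  \<open>t = 0\<close>.\<close>

lemma congruence_subgroups_trivial:
  assumes n: "\<bar>n\<bar> \<ge> 2" and r: "r \<in> localization n"
    and mem: "\<And>m. even m \<Longrightarrow> m > 0 \<Longrightarrow> (r, k) \<in> congruence_subgroup n m"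
  shows "(r, k) = (0, 0)"
proof -
  obtain e t where t: "r * of_int n ^ e = of_int t"
    using r by (auto simp: localization_def elim: Ints_cases)
  \<comment> \<open>Even, and larger than both \<open>\<bar>k\<bar>\<close> and
    \<open>\<bar>t\<bar> + 1\<close>.\<close>
  define m where "m = 2 * (nat \<bar>t\<bar> + nat \<bar>k\<bar> + 1)"
  have m: "even m" "m > 0" by (simp_all add: m_def)
  have "int m < 2 ^ m" by (metis of_nat_less_numeral_power_cancel_iff less_exp)
  also have "(2 :: int) ^ m \<le> \<bar>n\<bar> ^ m" using n by (intro power_mono) auto
  also have "\<dots> = n ^ m" using m(1) by (simp add: power_even_abs)
  finally have big: "int m < n ^ m" .
  have k: "int m dvd k" and r': "r / (of_int n ^ m - 1) \<in> localization n"
    using mem[OF m] by (auto simp: congruence_subgroup_def)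
  have "\<bar>k\<bar> < \<bar>int m\<bar>" "\<bar>t\<bar> + 1 < int m" by (simp_all add: m_def)
  then have small: "\<bar>k\<bar> < \<bar>int m\<bar>" "\<bar>t\<bar> < \<bar>n ^ m - 1\<bar>" using big by linarith+
  have "k = 0" using small(1) dvd_imp_le_int[OF _ k] by linarith
  have "of_int t / of_int (n ^ m - 1) = r / (of_int n ^ m - 1) * of_int n ^ e" by (simp flip: t)
  also have "\<dots> \<in> localization n" by (intro localization_mult r' Ints_localization) simp
  finally have "n ^ m - 1 dvd t"
  proof (rule dvd_of_localization[rotated 2])
    have "coprime (n ^ m - 1) (n ^ m)" by (rule coprime_diff_one_left)
    then show "coprime (n ^ m - 1) n" using m(2) by simp
  qed (use big m in auto)
  then have "t = 0" using small(2) dvd_imp_le_int[of t "n ^ m - 1"] by linarith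
  then show ?thesis using t n \<open>k = 0\<close> by auto
qed

theorem theorem3p4:
  fixes n :: int
  assumes "\<bar>n\<bar> \<ge> 2"
  shows "pseudocentre (BS1 n) = {\<one>\<^bsub>BS1 n\<^esub>}"
proof
  have n0: "n \<noteq> 0" using assms by auto
  interpret B: group "BS1 n" by (rule group_BS1)
  interpret A: group "affine_group n" by (rule group_affine_group[OF n0])
  obtain \<phi> where \<phi>: "\<phi> \<in> hom (BS1 n) (affine_group n)"
    and a: "\<phi> (bs_elt n gen_a) = (1, 0)" and b: "\<phi> (bs_elt n gen_b) = (0, 1)"
    using BS1_hom_affine_group[OF n0] .
  interpret \<phi>: group_hom "BS1 n" "affine_group n" \<phi> using \<phi> by unfold_locales
  have cent: "normal_closure (BS1 n) (centralizer (BS1 n) x) \<lhd> BS1 n" for x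
    by (intro B.normal_closure_normal) (auto simp: centralizer_def)
  show "{\<one>\<^bsub>BS1 n\<^esub>} \<subseteq> pseudocentre (BS1 n)"
    using subgroup.one_closed[OF normal_imp_subgroup[OF cent]] by (auto simp: pseudocentre_def)
  show "pseudocentre (BS1 n) \<subseteq> {\<one>\<^bsub>BS1 n\<^esub>}"
  proof
    fix g assume g: "g \<in> pseudocentre (BS1 n)"
    \<comment> \<open>Any single member of the intersection would do; the one for the identity is at
      hand.\<close>
    have gc: "g \<in> carrier (BS1 n)"
      using g normal_imp_subgroup[OF cent[of "\<one>\<^bsub>BS1 n\<^esub>"]]
      by (auto simp: pseudocentre_def dest: subgroup.mem_carrier)
    have mem: "\<phi> g \<in> congruence_subgroup n m" if m: "even m" "m > 0" for m
    proof -
      \<comment> \<open>A preimage under \<phi> of the element \<open>(n ^ m - 1, 2 m)\<close>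
        treated in \<open>commuting_congruence_subgroup\<close>.\<close>
      define x where "x = bs_elt n gen_a [^]\<^bsub>BS1 n\<^esub> (n ^ m - 1) \<otimes>\<^bsub>BS1 n\<^esub> bs_elt n gen_b [^]\<^bsub>BS1 n\<^esub> int (2 * m)"
      have x: "x \<in> carrier (BS1 n)" by (simp add: x_def bs_elt_closed)
      have \<phi>x: "\<phi> x = (of_int n ^ m - 1, int (2 * m))"
        by (simp add: x_def \<phi>.hom_int_pow bs_elt_closed a b affine_group_translation_pow
            affine_group_dilation_pow n0 del: of_nat_mult)
      \<comment> \<open>The argument pulls the congruence subgroup back along \<phi>: \<phi>
        preserves commutation, and preimages of normal subgroups are normal.\<close>
      have "centralizer (BS1 n) x \<subseteq> {g \<in> carrier (BS1 n). \<phi> g \<in> congruence_subgroup n m}"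
      proof safe
        fix c assume c: "c \<in> centralizer (BS1 n) x"
        then show cc: "c \<in> carrier (BS1 n)" by (simp add: centralizer_def)
        have "\<phi> (c \<otimes>\<^bsub>BS1 n\<^esub> x) = \<phi> (x \<otimes>\<^bsub>BS1 n\<^esub> c)" using c by (simp add: centralizer_def)
        then have "\<phi> c \<otimes>\<^bsub>affine_group n\<^esub> \<phi> x = \<phi> x \<otimes>\<^bsub>affine_group n\<^esub> \<phi> c" using cc x by simp
        moreover have "fst (\<phi> c) \<in> localization n" using \<phi>.hom_closed[OF cc] by simp
        ultimately show "\<phi> c \<in> congruence_subgroup n m"
          using commuting_congruence_subgroup[OF assms m, of "fst (\<phi> c)" "snd (\<phi> c)"] \<phi>x by simp
      qed
      moreover have "n ^ m \<noteq> 1"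
        using two_le_abs_power[OF assms m(2)] by auto
      ultimately have "normal_closure (BS1 n) (centralizer (BS1 n) x) \<subseteq>
          {g \<in> carrier (BS1 n). \<phi> g \<in> congruence_subgroup n m}"
        by (intro normal_closure_minimal \<phi>.normal_preimage congruence_subgroup_normal n0)
      then show ?thesis using g x by (auto simp: pseudocentre_def)
    qed
    have "\<phi> g = (0, 0)"
      using congruence_subgroups_trivial[OF assms, of "fst (\<phi> g)" "snd (\<phi> g)"] mem \<phi>.hom_closed[OF gc]
      by simp
    then show "g \<in> {\<one>\<^bsub>BS1 n\<^esub>}"
      using BS1_hom_affine_group_trivial_kernel[OF assms \<phi> a b gc] by simp
  qed
qed

end
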